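(* Let $n\ge 2$ and $N_1,\dots,N_n\ge 1$ be integers, and let $G$ be a simple graph with at least one edge on the vertex set $\{v_{i_1,i_2,\dots,i_n} : 1\le i_k\le N_k \text{ for } k=1,\dots,n\}$. Let $G'$ be the graph theoretical partial transpose (GTPT) of $G$. Suppose that $G$ is degree symmetric, i.e. $d_G(u)=d_{G'}(u)$ for every vertex $u$. If $\rho_l(G)$ is fully separable in $\mathbb{C}^{N_1}\otimes\cdots\otimes\mathbb{C}^{N_n}$, then $\rho_l(G')$ is fully separable in $\mathbb{C}^{N_1}\otimes\cdots\otimes\mathbb{C}^{N_n}$.
   Context: Graphs are finite, undirected and simple (no loops, no multiple edges); an edge $(a,b)$ is the same as $(b,a)$. $d_G(u)$ is the degree of the vertex $u$ in $G$, $D(G)$ is the diagonal degree matrix, and $A(G)$ is the $0/1$ adjacency matrix. Put $L(G)=D(G)-A(G)$ and define (for $G$ with at least one edge) $$\rho_l(G)=\frac{L(G)}{\mathrm{tr}(L(G))}.$$ The vertex $v_{i_1,\dots,i_n}$ is identified with the integer $(i_1-1)N_2N_3\cdots N_n+(i_2-1)N_3\cdots N_n+\cdots+(i_{n-1}-1)N_n+i_n$, so that the matrices above act on $\mathbb{C}^{N_1}\otimes\cdots\otimes\mathbb{C}^{N_n}$, with $v_{i_1,\dots,i_n}$ corresponding to the basis vector $e_{i_1}\otimes\cdots\otimes e_{i_n}$. GTPT: $G'$ is the simple graph on the same vertex set (same labelling) obtained from $G$ by replacing every edge $(v_{i_1,i_2,\dots,i_n},v_{j_1,j_2,\dots,j_n})$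 of $G$ with $i_1\ne j_1$ by $(v_{j_1,i_2,\dots,i_n},v_{i_1,j_2,\dots,j_n})$ (all simultaneously), and keeping all other edges unchanged. A density matrix is a positive semidefinite Hermitian matrix of trace $1$. A density matrix $\rho$ on $H_1\otimes\cdots\otimes H_n$ is fully separable if $\rho=\sum_i p_i\,\rho_i^1\otimes\cdots\otimes\rho_i^n$ (finite sum) with $p_i\ge 0$, $\sum_i p_i=1$, and each $\rho_i^j$ a density matrix on $H_j$. *)

theory Defs
  imports "Jordan_Normal_Form.Schur_Decomposition" "Graph_Theory.Pair_Digraph"
begin

section \<open>Vertex labels and their numbering\<close>

text \<open>A list \<open>Ns = [N\<^sub>1, \<dots>, N\<^sub>n]\<close> gives the local dimensions. The vertex
  \<open>v\<close> with indices \<open>i\<^sub>1, \<dots>, i\<^sub>n\<close> is the list \<open>[i\<^sub>1, \<dots>, i\<^sub>n]\<close>, with indices starting at 1.\<close>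

definition vertex_labels :: "nat list \<Rightarrow> nat list set" where
  "vertex_labels Ns = {u. length u = length Ns \<and> (\<forall>k<length Ns. 1 \<le> u ! k \<and> u ! k \<le> Ns ! k)}"

text \<open>The number \<open>(i\<^sub>1 - 1) N\<^sub>2 \<cdots> N\<^sub>n + \<cdots> + (i\<^sub>n\<^sub>-\<^sub>1 - 1) N\<^sub>n + i\<^sub>n\<close> of a vertex; the last
  summand \<open>i\<^sub>n\<close> is written as \<open>(i\<^sub>n - 1) + 1\<close>.\<close>

definition vertex_number :: "nat list \<Rightarrow> nat list \<Rightarrow> nat" where
  "vertex_number Ns u = (\<Sum>k<length Ns. (u ! k - 1) * prod_list (drop (Suc k) Ns)) + 1"

text \<open>Rows and columns of matrices are counted from 0, so row \<open>r\<close> belongs to the vertex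
  with number \<open>r + 1\<close>. This is well defined by \<open>bij_betw_vertex_number\<close> below.\<close>

definition vertex_at :: "nat list \<Rightarrow> nat \<Rightarrow> nat list" where
  "vertex_at Ns r = inv_into (vertex_labels Ns) (vertex_number Ns) (r + 1)"

lemma vertex_labels_Nil: "vertex_labels [] = {[]}"
  by (auto simp: vertex_labels_def)

lemma vertex_labels_Cons:
  "vertex_labels (N # Ns) = {i # u |i u. 1 \<le> i \<and> i \<le> N \<and> u \<in> vertex_labels Ns}"
proof (intro equalityI subsetI)
  fix w assume "w \<in> vertex_labels (N # Ns)"
  then have len: "length w = Suc (length Ns)"
    and bnd: "\<And>k. k < Suc (length Ns) \<Longrightarrow> 1 \<le> w ! k \<and> w ! k \<le> (N # Ns) ! k"
    by (auto simp: vertex_labels_def)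
  from len obtain i u where w: "w = i # u" by (cases w) auto
  from bnd[of 0] w have "1 \<le> i \<and> i \<le> N" by simp
  moreover have "u \<in> vertex_labels Ns"
    using len bnd[of "Suc k" for k] w by (auto simp: vertex_labels_def)
  ultimately show "w \<in> {i # u |i u. 1 \<le> i \<and> i \<le> N \<and> u \<in> vertex_labels Ns}"
    using w by blast
next
  fix w assume "w \<in> {i # u |i u. 1 \<le> i \<and> i \<le> N \<and> u \<in> vertex_labels Ns}"
  then show "w \<in> vertex_labels (N # Ns)"
    by (auto simp: vertex_labels_def nth_Cons split: nat.splits)
qed

lemma vertex_number_Nil: "vertex_number [] u = 1"
  by (simp add: vertex_number_def)

lemma vertex_number_Cons:
  "vertex_number (N # Ns) (i # u) = (i - 1) * prod_list Ns + vertex_number Ns u"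
  by (simp add: vertex_number_def sum.lessThan_Suc_shift del: sum.lessThan_Suc)

lemma bij_betw_vertex_number:
  "bij_betw (vertex_number Ns) (vertex_labels Ns) {1..prod_list Ns}"
proof (induction Ns)
  case Nil
  show ?case by (simp add: vertex_labels_Nil vertex_number_Nil bij_betw_def)
next
  case (Cons N Ns)
  let ?P = "prod_list Ns"
  have rng: "vertex_number Ns u \<in> {1..?P}" if "u \<in> vertex_labels Ns" for u
    using Cons.IH that by (auto simp: bij_betw_def)
  have dm: "(vertex_number (N # Ns) (i # u) - 1) div ?P = i - 1"
      "(vertex_number (N # Ns) (i # u) - 1) mod ?P = vertex_number Ns u - 1"
    if "u \<in> vertex_labels Ns" for i u
  proof -
    have *: "vertex_number (N # Ns) (i # u) - 1 = (vertex_number Ns u - 1) + ?P * (i - 1)"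
      and lt: "vertex_number Ns u - 1 < ?P"
      using rng[OF that] by (auto simp: vertex_number_Cons mult.commute)
    then have "?P \<noteq> 0" by linarith
    then show "(vertex_number (N # Ns) (i # u) - 1) div ?P = i - 1"
      "(vertex_number (N # Ns) (i # u) - 1) mod ?P = vertex_number Ns u - 1"
      unfolding * using lt by simp_all
  qed
  have "inj_on (vertex_number (N # Ns)) (vertex_labels (N # Ns))"
  proof (rule inj_onI)
    fix x y assume "x \<in> vertex_labels (N # Ns)" "y \<in> vertex_labels (N # Ns)"
      and eq: "vertex_number (N # Ns) x = vertex_number (N # Ns) y"
    then obtain i u j v where x: "x = i # u" "1 \<le> i" "u \<in> vertex_labels Ns"
      and y: "y = j # v" "1 \<le> j" "v \<in> vertex_labels Ns"
      by (auto simp: vertex_labels_Cons)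
    from dm(1)[OF x(3), of i] dm(1)[OF y(3), of j] eq x y have "i - 1 = j - 1" by simp
    with x y have ij: "i = j" by simp
    from dm(2)[OF x(3), of i] dm(2)[OF y(3), of j] eq x y
    have "vertex_number Ns u - 1 = vertex_number Ns v - 1" by simp
    with rng[OF x(3)] rng[OF y(3)] have "vertex_number Ns u = vertex_number Ns v" by auto
    with Cons.IH x(3) y(3) have "u = v" by (auto simp: bij_betw_def inj_on_def)
    with ij x y show "x = y" by simp
  qed
  moreover have "vertex_number (N # Ns) ` vertex_labels (N # Ns) = {1..prod_list (N # Ns)}"
  proof (intro equalityI subsetI)
    fix r assume "r \<in> vertex_number (N # Ns) ` vertex_labels (N # Ns)"
    then obtain i u where r: "r = (i - 1) * ?P + vertex_number Ns u" "1 \<le> i" "i \<le> N"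
        "u \<in> vertex_labels Ns"
      by (auto simp: vertex_labels_Cons vertex_number_Cons)
    then have "r \<le> (i - 1) * ?P + ?P" "1 \<le> r" using rng[of u] by auto
    moreover have "(i - 1) * ?P + ?P = i * ?P" using r(2) by (cases i) auto
    moreover have "i * ?P \<le> N * ?P" using r(3) by simp
    ultimately have "1 \<le> r" "r \<le> N * ?P" by linarith+
    then show "r \<in> {1..prod_list (N # Ns)}" by simp
  next
    fix r assume "r \<in> {1..prod_list (N # Ns)}"
    then have r: "1 \<le> r" "r - 1 < N * ?P" by auto
    then have P: "0 < ?P" by (cases ?P) auto
    let ?i = "(r - 1) div ?P + 1"
    have "(r - 1) mod ?P + 1 \<in> {1..?P}" using P by (auto simp: Suc_le_eq)
    with Cons.IH obtain u where u: "u \<in> vertex_labels Ns" "vertex_number Ns u = (r - 1) mod ?P + 1"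
      unfolding bij_betw_def by (metis imageE)
    have "?i \<le> N" using r(2) P by (simp add: less_mult_imp_div_less Suc_le_eq)
    then have "?i # u \<in> vertex_labels (N # Ns)" using u(1) by (auto simp: vertex_labels_Cons)
    moreover have "vertex_number (N # Ns) (?i # u) = r"
      using u(2) r(1) by (simp add: vertex_number_Cons)
    ultimately show "r \<in> vertex_number (N # Ns) ` vertex_labels (N # Ns)" by (metis imageI)
  qed
  ultimately show ?case by (simp add: bij_betw_def)
qed

section \<open>Graphs and their matrices\<close>

text \<open>A finite simple undirected graph is a \<open>pair_graph\<close>: its arc set is symmetric and
  loop-free, the edge between \<open>a\<close> and \<open>b\<close> being the pair of arcs \<open>(a, b)\<close>, \<open>(b, a)\<close>.
  Hence the degree of a vertex is its number of outgoing arcs.\<close>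

abbreviation vertex_degree :: "'a pair_pre_digraph \<Rightarrow> 'a \<Rightarrow> nat" where
  "vertex_degree G u \<equiv> out_degree (with_proj G) u"

definition degree_matrix :: "nat list \<Rightarrow> nat list pair_pre_digraph \<Rightarrow> complex mat" where
  "degree_matrix Ns G = mat_diag (prod_list Ns) (\<lambda>r. of_nat (vertex_degree G (vertex_at Ns r)))"

definition adjacency_matrix :: "nat list \<Rightarrow> nat list pair_pre_digraph \<Rightarrow> complex mat" where
  "adjacency_matrix Ns G = mat (prod_list Ns) (prod_list Ns)
     (\<lambda>(r, s). if (vertex_at Ns r, vertex_at Ns s) \<in> parcs G then 1 else 0)"

definition laplacian :: "nat list \<Rightarrow> nat list pair_pre_digraph \<Rightarrow> complex mat" where
  "laplacian Ns G = degree_matrix Ns G - adjacency_matrix Ns G"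

definition mat_trace :: "'a :: comm_monoid_add mat \<Rightarrow> 'a" where
  "mat_trace A = (\<Sum>r<dim_row A. A $$ (r, r))"

definition rho_l :: "nat list \<Rightarrow> nat list pair_pre_digraph \<Rightarrow> complex mat" where
  "rho_l Ns G = (1 / mat_trace (laplacian Ns G)) \<cdot>\<^sub>m laplacian Ns G"

text \<open>The partial transpose swaps the first indices of the end points of an edge whenever they
  differ. It maps the two arcs of an edge to the two arcs of the new edge.\<close>

definition gtpt_arc :: "nat list \<times> nat list \<Rightarrow> nat list \<times> nat list" where
  "gtpt_arc e = (case e of (u, v) \<Rightarrow>
     if hd u \<noteq> hd v then (hd v # tl u, hd u # tl v) else (u, v))"

definition gtpt :: "nat list pair_pre_digraph \<Rightarrow> nat list pair_pre_digraph" where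
  "gtpt G = \<lparr> pverts = pverts G, parcs = gtpt_arc ` parcs G \<rparr>"

definition degree_symmetric :: "nat list pair_pre_digraph \<Rightarrow> bool" where
  "degree_symmetric G \<longleftrightarrow> (\<forall>u \<in> pverts G. vertex_degree G u = vertex_degree (gtpt G) u)"

section \<open>Density matrices and full separability\<close>

text \<open>In the order on complex numbers, \<open>0 \<le> z\<close> means that \<open>z\<close> is real and nonnegative.\<close>

definition density_matrix :: "nat \<Rightarrow> complex mat \<Rightarrow> bool" where
  "density_matrix d A \<longleftrightarrow> A \<in> carrier_mat d d \<and> mat_adjoint A = A \<and>
     (\<forall>x \<in> carrier_vec d. 0 \<le> (A *\<^sub>v x) \<bullet>c x) \<and> mat_trace A = 1"

definition kronecker :: "'a :: times mat \<Rightarrow> 'a mat \<Rightarrow> 'a mat" where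
  "kronecker A B = mat (dim_row A * dim_row B) (dim_col A * dim_col B)
     (\<lambda>(r, s). A $$ (r div dim_row B, s div dim_col B) * B $$ (r mod dim_row B, s mod dim_col B))"

definition kronecker_list :: "'a :: semiring_1 mat list \<Rightarrow> 'a mat" where
  "kronecker_list As = foldr kronecker As (1\<^sub>m 1)"

text \<open>The witnesses are \<open>m\<close> weights \<open>p i\<close> and matrices \<open>R i j\<close>; the factors
  are numbered from 0. The sum is a fold as matrices of varying dimension form no monoid.\<close>

definition fully_separable :: "nat list \<Rightarrow> complex mat \<Rightarrow> bool" where
  "fully_separable Ns A \<longleftrightarrow> density_matrix (prod_list Ns) A \<and>
     (\<exists>(m :: nat) (p :: nat \<Rightarrow> real) (R :: nat \<Rightarrow> nat \<Rightarrow> complex mat).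
        (\<forall>i<m. 0 \<le> p i) \<and> (\<Sum>i<m. p i) = 1 \<and>
        (\<forall>i<m. \<forall>j<length Ns. density_matrix (Ns ! j) (R i j)) \<and>
        A = foldr (+)
              (map (\<lambda>i. of_real (p i) \<cdot>\<^sub>m kronecker_list (map (R i) [0..<length Ns])) [0..<m])
              (0\<^sub>m (prod_list Ns) (prod_list Ns)))"

text \<open>With the row-major numbering of the vertices, the Kronecker product is the tensor product
  in the basis \<open>e\<close> indexed by the vertices.\<close>

lemma kronecker_list_entry:
  assumes "length As = length Ns" "\<forall>k<length Ns. As ! k \<in> carrier_mat (Ns ! k) (Ns ! k)"
    and "u \<in> vertex_labels Ns" "v \<in> vertex_labels Ns"
  shows "kronecker_list As \<in> carrier_mat (prod_list Ns) (prod_list Ns) \<and>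
    kronecker_list As $$ (vertex_number Ns u - 1, vertex_number Ns v - 1)
     = (\<Prod>k<length Ns. As ! k $$ (u ! k - 1, v ! k - (1 :: nat)) :: 'a :: comm_semiring_1)"
  using assms
proof (induction Ns arbitrary: As u v)
  case Nil
  then show ?case by (simp add: kronecker_list_def vertex_number_Nil)
next
  case (Cons N Ns)
  let ?P = "prod_list Ns"
  from Cons.prems(1) obtain B Bs where As: "As = B # Bs" "length Bs = length Ns"
    by (cases As) auto
  from Cons.prems(2) As have B: "B \<in> carrier_mat N N"
    and Bs: "\<forall>k<length Ns. Bs ! k \<in> carrier_mat (Ns ! k) (Ns ! k)"
    by (auto simp: nth_Cons split: nat.splits)
  from Cons.prems(3,4) obtain i w j x where u: "u = i # w" "1 \<le> i" "i \<le> N" "w \<in> vertex_labels Ns"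
    and v: "v = j # x" "1 \<le> j" "j \<le> N" "x \<in> vertex_labels Ns"
    by (auto simp: vertex_labels_Cons)
  note IH = Cons.IH[OF As(2) Bs u(4) v(4)]
  have bnd: "1 \<le> vertex_number Ns y" "vertex_number Ns y \<le> ?P" if "y \<in> vertex_labels Ns" for y
    using bij_betw_vertex_number[of Ns] that by (auto simp: bij_betw_def)
  have bnd': "vertex_number (N # Ns) y - 1 < N * ?P" if "y \<in> vertex_labels (N # Ns)" for y
  proof -
    have "vertex_number (N # Ns) y \<in> {1..N * ?P}"
      using bij_betw_vertex_number[of "N # Ns"] that by (auto simp: bij_betw_def)
    then show ?thesis by auto
  qed
  have split: "vertex_number (N # Ns) (l # y) - 1 = (vertex_number Ns y - 1) + ?P * (l - 1)"
    "vertex_number Ns y - 1 < ?P" if "y \<in> vertex_labels Ns" for l y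
    using bnd[OF that] by (auto simp: vertex_number_Cons mult.commute)
  have P: "?P \<noteq> 0" using split(2)[OF u(4)] by linarith
  have K: "kronecker_list As = kronecker B (kronecker_list Bs)"
    by (simp add: kronecker_list_def As)
  have dims: "dim_row (kronecker_list Bs) = ?P" "dim_col (kronecker_list Bs) = ?P"
    "dim_row B = N" "dim_col B = N" using IH B by auto
  have dm: "(vertex_number (N # Ns) (l # y) - 1) div ?P = l - 1"
    "(vertex_number (N # Ns) (l # y) - 1) mod ?P = vertex_number Ns y - 1"
    if "y \<in> vertex_labels Ns" for l y
    unfolding split(1)[OF that] using split(2)[OF that] P by simp_all
  have "kronecker_list As $$ (vertex_number (N # Ns) u - 1, vertex_number (N # Ns) v - 1)
     = B $$ (i - 1, j - 1) * kronecker_list Bs $$ (vertex_number Ns w - 1, vertex_number Ns x - 1)"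
    unfolding K kronecker_def dims
    using bnd'[OF Cons.prems(3)] bnd'[OF Cons.prems(4)] dm[OF u(4), of i] dm[OF v(4), of j] u(1) v(1)
    by simp
  moreover have "kronecker_list As \<in> carrier_mat (prod_list (N # Ns)) (prod_list (N # Ns))"
    unfolding K kronecker_def dims by simp
  ultimately show ?case using IH
    by (simp add: prod.lessThan_Suc_shift As(1) u(1) v(1) del: prod.lessThan_Suc)
qed

end

theory Submission
  imports Defs
begin

text \<open>When \<open>G\<close> is degree symmetric, \<open>\<rho>\<^sub>l(G')\<close> is the partial transpose of \<open>\<rho>\<^sub>l(G)\<close> with
  respect to the first factor, and transposing the first factor of every product in a separable
  decomposition yields product states again. Positivity of \<open>\<rho>\<^sub>l(G')\<close> need not be derived from
  the decomposition: it holds because \<open>L(G')\<close> is the Laplacian of a graph.\<close>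

section \<open>Density matrices\<close>

lemma mat_adjoint_eq_iff:
  fixes A :: "complex mat"
  assumes "A \<in> carrier_mat d d"
  shows "mat_adjoint A = A \<longleftrightarrow> (\<forall>r<d. \<forall>s<d. cnj (A $$ (s, r)) = A $$ (r, s))"
proof -
  have "mat_adjoint A \<in> carrier_mat d d"
    using assms by (auto simp: mat_adjoint_def)
  moreover have "mat_adjoint A $$ (r, s) = cnj (A $$ (s, r))" if "r < d" "s < d" for r s
    using assms that by (simp add: mat_adjoint_def mat_of_rows_def)
  ultimately show ?thesis
    using assms by (auto simp: mat_eq_iff)
qed

lemma quadratic_form_eq_sum:
  fixes A :: "complex mat"
  assumes "A \<in> carrier_mat d d" "x \<in> carrier_vec d"
  shows "(A *\<^sub>v x) \<bullet>c x = (\<Sum>r<d. \<Sum>s<d. A $$ (r, s) * x $ s * cnj (x $ r))"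
  using assms by (simp add: scalar_prod_def sum_distrib_right atLeast0LessThan)

text \<open>Only the values of \<open>f\<close> below \<open>d\<close> enter the form, so arbitrary
  functions can stand for vectors. This leaves conditions on entries and finite sums only.\<close>

lemma density_matrix_iff:
  assumes "A \<in> carrier_mat d d"
  shows "density_matrix d A \<longleftrightarrow>
    (\<forall>r<d. \<forall>s<d. cnj (A $$ (s, r)) = A $$ (r, s)) \<and>
    (\<forall>f. 0 \<le> (\<Sum>r<d. \<Sum>s<d. A $$ (r, s) * f s * cnj (f r))) \<and>
    (\<Sum>r<d. A $$ (r, r)) = 1"
proof -
  have "(\<forall>x \<in> carrier_vec d. 0 \<le> (A *\<^sub>v x) \<bullet>c x) \<longleftrightarrow>
    (\<forall>f. 0 \<le> (\<Sum>r<d. \<Sum>s<d. A $$ (r, s) * f s * cnj (f r)))" (is "?L \<longleftrightarrow> ?R")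
  proof
    assume L: ?L
    show ?R
    proof
      fix f
      have "0 \<le> (A *\<^sub>v vec d f) \<bullet>c vec d f"
        using L by simp
      then show "0 \<le> (\<Sum>r<d. \<Sum>s<d. A $$ (r, s) * f s * cnj (f r))"
        by (simp add: quadratic_form_eq_sum[OF assms])
    qed
  next
    assume ?R
    then show ?L
      by (simp add: quadratic_form_eq_sum[OF assms])
  qed
  then show ?thesis
    using assms by (auto simp: density_matrix_def mat_adjoint_eq_iff mat_trace_def)
qed

text \<open>After exchanging the two sums, the quadratic form of the transpose at \<open>f\<close>
  is the form of \<open>A\<close> at the conjugate of \<open>f\<close>, so positivity carries
  over.\<close>

lemma density_matrix_transpose:
  assumes "density_matrix d A"
  shows "density_matrix d (transpose_mat A)"
proof -
  have A: "A \<in> carrier_mat d d"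
    using assms by (simp add: density_matrix_def)
  note dens = assms[unfolded density_matrix_iff[OF A]]
  have "0 \<le> (\<Sum>r<d. \<Sum>s<d. A $$ (s, r) * f s * cnj (f r))" for f
  proof -
    have "0 \<le> (\<Sum>r<d. \<Sum>s<d. A $$ (r, s) * cnj (f s) * cnj (cnj (f r)))"
      using dens by (auto dest: spec[of _ "\<lambda>r. cnj (f r)"])
    also have "\<dots> = (\<Sum>r<d. \<Sum>s<d. A $$ (s, r) * f s * cnj (f r))"
      by (subst sum.swap) (simp add: mult.commute mult.left_commute)
    finally show ?thesis .
  qed
  moreover have "transpose_mat A \<in> carrier_mat d d"
    using A by simp
  ultimately show ?thesis
    using A dens by (subst density_matrix_iff) auto
qed

section \<open>Laplacians\<close>

lemma bij_betw_vertex_at: "bij_betw (vertex_at Ns) {..<prod_list Ns} (vertex_labels Ns)"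
proof -
  have "bij_betw (inv_into (vertex_labels Ns) (vertex_number Ns)) {1..prod_list Ns} (vertex_labels Ns)"
    by (rule bij_betw_inv_into[OF bij_betw_vertex_number])
  \<comment> \<open>Rows start at 0 and vertex numbers at 1, hence the shift before inverting the
    numbering.\<close>
  moreover have "bij_betw (\<lambda>r. r + 1) {..<prod_list Ns} {1..prod_list Ns}"
    by (rule bij_betwI[of _ _ _ "\<lambda>r. r - 1"]) auto
  ultimately have "bij_betw (inv_into (vertex_labels Ns) (vertex_number Ns) \<circ> (\<lambda>r. r + 1))
      {..<prod_list Ns} (vertex_labels Ns)"
    by (rule bij_betw_trans[rotated])
  then show ?thesis
    by (simp add: vertex_at_def comp_def cong: bij_betw_cong)
qed

lemma vertex_at_in_labels: "r < prod_list Ns \<Longrightarrow> vertex_at Ns r \<in> vertex_labels Ns"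
  using bij_betwE[OF bij_betw_vertex_at] by blast

lemma vertex_number_vertex_at: "r < prod_list Ns \<Longrightarrow> vertex_number Ns (vertex_at Ns r) = r + 1"
  unfolding vertex_at_def by (rule bij_betw_inv_into_right[OF bij_betw_vertex_number]) simp

lemma vertex_number_bounds:
  "u \<in> vertex_labels Ns \<Longrightarrow> 1 \<le> vertex_number Ns u \<and> vertex_number Ns u \<le> prod_list Ns"
  using bij_betwE[OF bij_betw_vertex_number] by fastforce

lemma vertex_number_less: "u \<in> vertex_labels Ns \<Longrightarrow> vertex_number Ns u - 1 < prod_list Ns"
  using vertex_number_bounds[of u Ns] by linarith

lemma vertex_at_vertex_number:
  "u \<in> vertex_labels Ns \<Longrightarrow> vertex_at Ns (vertex_number Ns u - 1) = u"
  using vertex_number_bounds[of u Ns] bij_betw_inv_into_left[OF bij_betw_vertex_number, of u Ns]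
  by (simp add: vertex_at_def)

lemma laplacian_carrier [simp]: "laplacian Ns G \<in> carrier_mat (prod_list Ns) (prod_list Ns)"
  by (auto simp: laplacian_def degree_matrix_def adjacency_matrix_def)

lemma laplacian_entry:
  assumes "r < prod_list Ns" "s < prod_list Ns"
  shows "laplacian Ns G $$ (r, s) =
    (if r = s then of_nat (vertex_degree G (vertex_at Ns r)) else 0) -
    of_bool ((vertex_at Ns r, vertex_at Ns s) \<in> parcs G)"
  using assms by (simp add: laplacian_def degree_matrix_def adjacency_matrix_def mat_diag_def)

text \<open>The partial transpose acts on labels, so entries are addressed by labels here. As
  \<open>vertex_at\<close> inverts the numbering, diagonal positions are exactly those with equal
  labels.\<close>

lemma laplacian_entry_labels:
  assumes "u \<in> vertex_labels Ns" "v \<in> vertex_labels Ns"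
  shows "laplacian Ns G $$ (vertex_number Ns u - 1, vertex_number Ns v - 1) =
    (if u = v then of_nat (vertex_degree G u) else 0) - of_bool ((u, v) \<in> parcs G)"
proof -
  have "vertex_number Ns u - 1 = vertex_number Ns v - 1 \<longleftrightarrow> u = v"
    using assms vertex_at_vertex_number by metis
  then show ?thesis
    by (simp only: laplacian_entry vertex_number_less vertex_at_vertex_number assms)
qed

text \<open>The degree as a row sum of the adjacency matrix: an arc leaving \<open>u\<close> is
  determined by its head, which is again a label.\<close>

lemma vertex_degree_eq_sum:
  assumes "pair_graph G" "pverts G = vertex_labels Ns"
  shows "(of_nat (vertex_degree G u) :: 'a :: semiring_1) =
    (\<Sum>s<prod_list Ns. of_bool ((u, vertex_at Ns s) \<in> parcs G))"
proof -
  interpret pair_graph G by fact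
  have "vertex_degree G u = card {e \<in> parcs G. fst e = u}"
    by (simp add: out_degree_def out_arcs_def)
  also have "{e \<in> parcs G. fst e = u} = Pair u ` {v \<in> vertex_labels Ns. (u, v) \<in> parcs G}"
    using in_arcsD2 assms(2) by force
  also have "card \<dots> = card {v \<in> vertex_labels Ns. (u, v) \<in> parcs G}"
    by (rule card_image) (auto simp: inj_on_def)
  finally have "(of_nat (vertex_degree G u) :: 'a) = (\<Sum>v\<in>vertex_labels Ns. of_bool ((u, v) \<in> parcs G))"
    using pair_finite_verts assms(2) by (simp add: Collect_conj_eq)
  also have "\<dots> = (\<Sum>s<prod_list Ns. of_bool ((u, vertex_at Ns s) \<in> parcs G))"
    by (rule sum.reindex_bij_betw[OF bij_betw_vertex_at, symmetric])
  finally show ?thesis .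
qed

lemma mat_trace_laplacian:
  assumes "pair_graph G" "pverts G = vertex_labels Ns"
  shows "mat_trace (laplacian Ns G) = (\<Sum>u\<in>vertex_labels Ns. of_nat (vertex_degree G u))"
proof -
  interpret pair_graph G by fact
  have "mat_trace (laplacian Ns G) = (\<Sum>r<prod_list Ns. of_nat (vertex_degree G (vertex_at Ns r)))"
    \<comment> \<open>Without loops, the adjacency matrix contributes nothing to the
      diagonal.\<close>
    using carrier_matD[OF laplacian_carrier, of Ns G]
    by (fastforce simp: mat_trace_def laplacian_entry dest: pair_no_loops intro!: sum.cong)
  also have "\<dots> = (\<Sum>u\<in>vertex_labels Ns. of_nat (vertex_degree G u))"
    by (rule sum.reindex_bij_betw[OF bij_betw_vertex_at])
  finally show ?thesis .
qed

text \<open>This makes the normalisation in \<open>rho_l\<close> a division by a nonzero trace: the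
  tail of any arc has positive degree.\<close>

lemma degree_sum_pos:
  assumes "pair_graph G" "parcs G \<noteq> {}"
  shows "0 < (\<Sum>u\<in>pverts G. vertex_degree G u)"
proof -
  interpret pair_graph G by fact
  obtain u v where uv: "(u, v) \<in> parcs G"
    using assms(2) by auto
  then have "(u, v) \<in> {e \<in> parcs G. fst e = u}"
    by simp
  moreover have "finite {e \<in> parcs G. fst e = u}"
    using pair_finite_arcs by simp
  ultimately have "0 < vertex_degree G u"
    using card_gt_0_iff by (fastforce simp: out_degree_def out_arcs_def)
  then show ?thesis
    using in_arcsD1[OF uv] pair_finite_verts by (intro sum_pos2[of _ u]) auto
qed

text \<open>Twice the form equals the sum of \<open>(cmod (f r - f s))\<^sup>2\<close> over all
  ordered pairs of adjacent vertices, the usual sum-of-squares identity for a Laplacian.\<close>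

lemma laplacian_form_nonneg:
  assumes "pair_graph G" "pverts G = vertex_labels Ns"
  shows "0 \<le> (\<Sum>r<prod_list Ns. \<Sum>s<prod_list Ns. laplacian Ns G $$ (r, s) * f s * cnj (f r))"
    (is "0 \<le> ?S")
proof -
  interpret pair_graph G by fact
  let ?d = "prod_list Ns"
  define a where "a r s = (of_bool ((vertex_at Ns r, vertex_at Ns s) \<in> parcs G) :: real)" for r s
  have sym: "a r s = a s r" for r s
    using pair_sym_arcs by (auto simp: a_def symmetric_def sym_def)
  \<comment> \<open>Writing the degree as a row sum of \<open>a\<close> merges the diagonal and the
    adjacency terms into differences \<open>f r - f s\<close>.\<close>
  have row: "(\<Sum>s<?d. laplacian Ns G $$ (r, s) * f s * cnj (f r)) =
      (\<Sum>s<?d. of_real (a r s) * (f r - f s) * cnj (f r))" if r: "r < ?d" for r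
  proof -
    have "(\<Sum>s<?d. laplacian Ns G $$ (r, s) * f s * cnj (f r)) =
        (\<Sum>s<?d. (if r = s then of_nat (vertex_degree G (vertex_at Ns r)) * f r * cnj (f r) else 0)
           - of_real (a r s) * f s * cnj (f r))"
      using r by (intro sum.cong) (auto simp: laplacian_entry a_def algebra_simps)
    also have "\<dots> = of_nat (vertex_degree G (vertex_at Ns r)) * f r * cnj (f r)
        - (\<Sum>s<?d. of_real (a r s) * f s * cnj (f r))"
      using r by (simp add: sum_subtractf)
    also have "of_nat (vertex_degree G (vertex_at Ns r)) = (\<Sum>s<?d. complex_of_real (a r s))"
      unfolding vertex_degree_eq_sum[OF assms] a_def by (intro sum.cong) auto
    finally show ?thesis
      by (simp add: sum_distrib_right right_diff_distrib left_diff_distrib sum_subtractf)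
  qed
  have S: "?S = (\<Sum>r<?d. \<Sum>s<?d. of_real (a r s) * (f r - f s) * cnj (f r))"
    by (rule sum.cong[OF refl], rule row) simp
  \<comment> \<open>Since \<open>a\<close> is symmetric, \<open>r\<close> and \<open>s\<close> may
    be exchanged; adding both versions of the sum completes the squares.\<close>
  also have "\<dots> = (\<Sum>r<?d. \<Sum>s<?d. of_real (a r s) * (f s - f r) * cnj (f s))"
    by (subst sum.swap) (simp add: sym)
  finally have "2 * ?S = (\<Sum>r<?d. \<Sum>s<?d. of_real (a r s) * (f r - f s) * cnj (f r))
      + (\<Sum>r<?d. \<Sum>s<?d. of_real (a r s) * (f s - f r) * cnj (f s))"
    using S by simp
  also have "\<dots> = (\<Sum>r<?d. \<Sum>s<?d. of_real (a r s) * ((f r - f s) * cnj (f r - f s)))"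
    unfolding sum.distrib[symmetric] by (intro sum.cong refl) (simp add: algebra_simps)
  also have "\<dots> = of_real (\<Sum>r<?d. \<Sum>s<?d. a r s * (cmod (f r - f s))\<^sup>2)"
    by (simp only: complex_norm_square[symmetric] of_real_sum of_real_mult of_real_power)
  finally have "2 * ?S = of_real (\<Sum>r<?d. \<Sum>s<?d. a r s * (cmod (f r - f s))\<^sup>2)" .
  moreover have "0 \<le> (\<Sum>r<?d. \<Sum>s<?d. a r s * (cmod (f r - f s))\<^sup>2)"
    by (intro sum_nonneg) (auto simp: a_def)
  moreover have "0 \<le> z" if "2 * z = of_real t" "0 \<le> t" for z :: complex and t
    using that by (auto simp: less_eq_complex_def complex_eq_iff)
  ultimately show ?thesis
    by blast
qed

lemma density_matrix_rho_l:
  assumes "pair_graph G" "pverts G = vertex_labels Ns" "parcs G \<noteq> {}"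
  shows "density_matrix (prod_list Ns) (rho_l Ns G)"
proof -
  interpret pair_graph G by fact
  let ?d = "prod_list Ns"
  define t where "t = (\<Sum>u\<in>vertex_labels Ns. vertex_degree G u)"
  have tr: "mat_trace (laplacian Ns G) = of_nat t"
    by (simp add: mat_trace_laplacian[OF assms(1,2)] t_def)
  have t: "t > 0"
    using degree_sum_pos[OF assms(1,3)] assms(2) by (simp add: t_def)
  \<comment> \<open>The factor is written as \<open>of_real\<close> of a nonnegative real, so
    conjugation fixes it and multiplication by it keeps nonnegativity.\<close>
  have entry: "rho_l Ns G $$ (r, s) = of_real (1 / of_nat t) * laplacian Ns G $$ (r, s)"
    if "r < ?d" "s < ?d" for r s
    using that carrier_matD[OF laplacian_carrier, of Ns G] by (simp add: rho_l_def tr)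
  have "rho_l Ns G \<in> carrier_mat ?d ?d"
    by (simp add: rho_l_def)
  moreover have "cnj (rho_l Ns G $$ (s, r)) = rho_l Ns G $$ (r, s)" if "r < ?d" "s < ?d" for r s
  proof -
    have "(vertex_at Ns s, vertex_at Ns r) \<in> parcs G \<longleftrightarrow> (vertex_at Ns r, vertex_at Ns s) \<in> parcs G"
      using pair_sym_arcs by (auto simp: symmetric_def sym_def)
    then show ?thesis
      using that by (simp add: entry laplacian_entry)
  qed
  moreover have "0 \<le> (\<Sum>r<?d. \<Sum>s<?d. rho_l Ns G $$ (r, s) * f s * cnj (f r))" for f
  proof -
    let ?q = "\<Sum>r<?d. \<Sum>s<?d. laplacian Ns G $$ (r, s) * f s * cnj (f r)"
    have "(\<Sum>r<?d. \<Sum>s<?d. rho_l Ns G $$ (r, s) * f s * cnj (f r)) = of_real (1 / of_nat t) * ?q"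
      by (simp add: entry sum_distrib_left mult.assoc)
    moreover have "0 \<le> ?q"
      by (rule laplacian_form_nonneg[OF assms(1,2)])
    ultimately show ?thesis
      by (simp add: less_eq_complex_def)
  qed
  moreover have "(\<Sum>r<?d. rho_l Ns G $$ (r, r)) = 1"
  proof -
    have "(\<Sum>r<?d. rho_l Ns G $$ (r, r)) = of_real (1 / of_nat t) * mat_trace (laplacian Ns G)"
      using carrier_matD[OF laplacian_carrier, of Ns G]
      by (simp add: entry sum_distrib_left mat_trace_def)
    then show ?thesis
      using t by (simp add: tr)
  qed
  ultimately show ?thesis
    by (simp add: density_matrix_iff)
qed

section \<open>The graph theoretical partial transpose\<close>

text \<open>Swapping equal heads changes nothing, so the case distinction disappears. Nonemptiness
  is what lets \<open>hd\<close> and \<open>tl\<close> rebuild the lists in that case.\<close>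

lemma gtpt_arc_eq:
  assumes "u \<noteq> []" "v \<noteq> []"
  shows "gtpt_arc (u, v) = (hd v # tl u, hd u # tl v)"
  using assms by (cases u; cases v) (auto simp: gtpt_arc_def)

lemma vertex_labels_nonempty: "u \<in> vertex_labels Ns \<Longrightarrow> Ns \<noteq> [] \<Longrightarrow> u \<noteq> []"
  by (auto simp: vertex_labels_def)

lemma swap_first_in_labels:
  assumes "u \<in> vertex_labels Ns" "v \<in> vertex_labels Ns" "Ns \<noteq> []"
  shows "hd v # tl u \<in> vertex_labels Ns"
  using assms by (cases Ns) (auto simp: vertex_labels_Cons)

text \<open>On pairs of nonempty lists \<open>gtpt_arc\<close> is an involution, so membership in
  the image of the arc set is membership of the swapped pair in the arc set itself.\<close>

lemma gtpt_arc_iff: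
  assumes G: "pair_graph G" "pverts G = vertex_labels Ns" "Ns \<noteq> []"
    and "u \<noteq> []" "v \<noteq> []"
  shows "(u, v) \<in> parcs (gtpt G) \<longleftrightarrow> (hd v # tl u, hd u # tl v) \<in> parcs G"
proof
  interpret pair_graph G by fact
  assume "(u, v) \<in> parcs (gtpt G)"
  then obtain x y where xy: "(x, y) \<in> parcs G" "gtpt_arc (x, y) = (u, v)"
    by (auto simp: gtpt_def)
  then have ne: "x \<noteq> []" "y \<noteq> []"
    using in_arcsD1 in_arcsD2 G vertex_labels_nonempty by metis+
  with xy(2) have "x = hd v # tl u" "y = hd u # tl v"
    by (auto simp: gtpt_arc_eq)
  with xy(1) show "(hd v # tl u, hd u # tl v) \<in> parcs G"
    by simp
next
  assume "(hd v # tl u, hd u # tl v) \<in> parcs G"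
  moreover have "gtpt_arc (hd v # tl u, hd u # tl v) = (u, v)"
    using assms(4,5) by (simp add: gtpt_arc_eq)
  ultimately show "(u, v) \<in> parcs (gtpt G)"
    unfolding gtpt_def by (metis imageI pair_pre_digraph.select_convs(2))
qed

text \<open>Equal ends after the swap would force equal heads and equal tails, hence a loop in
  \<open>G\<close>. Symmetry survives because swapping heads commutes with reversing an arc.\<close>

lemma pair_graph_gtpt:
  assumes "pair_graph G" "pverts G = vertex_labels Ns" "Ns \<noteq> []"
  shows "pair_graph (gtpt G)"
proof -
  interpret pair_graph G by fact
  have arc: "\<exists>u v. (u, v) \<in> parcs G \<and> u \<in> vertex_labels Ns \<and> v \<in> vertex_labels Ns \<and>
      u \<noteq> [] \<and> v \<noteq> [] \<and> e = (hd v # tl u, hd u # tl v)" if "e \<in> parcs (gtpt G)" for e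
  proof -
    from that obtain u v where uv: "(u, v) \<in> parcs G" "e = gtpt_arc (u, v)"
      by (auto simp: gtpt_def)
    moreover from uv(1) have "u \<in> vertex_labels Ns" "v \<in> vertex_labels Ns"
      using in_arcsD1 in_arcsD2 assms(2) by auto
    moreover from this have "u \<noteq> []" "v \<noteq> []"
      using vertex_labels_nonempty assms(3) by auto
    ultimately show ?thesis
      using gtpt_arc_eq by blast
  qed
  have verts: "pverts (gtpt G) = vertex_labels Ns"
    by (simp add: gtpt_def assms(2))
  show ?thesis
  proof
    fix e assume e: "e \<in> parcs (gtpt G)"
    obtain u v where uv: "(u, v) \<in> parcs G" "u \<in> vertex_labels Ns" "v \<in> vertex_labels Ns"
        "u \<noteq> []" "v \<noteq> []" "e = (hd v # tl u, hd u # tl v)"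
      using arc[OF e] by blast
    then show "fst e \<in> pverts (gtpt G)" "snd e \<in> pverts (gtpt G)"
      using verts swap_first_in_labels assms(3) by auto
    have "u \<noteq> v"
      using pair_no_loops[OF uv(1)] by simp
    then show "fst e \<noteq> snd e"
      using uv(4-6) by (cases u; cases v) auto
  next
    show "finite (pverts (gtpt G))"
      using pair_finite_verts by (simp add: gtpt_def)
    show "finite (parcs (gtpt G))"
      using pair_finite_arcs by (simp add: gtpt_def)
    show "symmetric (with_proj (gtpt G))"
    proof (unfold symmetric_def, rule symI)
      fix x y assume "(x, y) \<in> arcs_ends (with_proj (gtpt G))"
      then have xy: "(x, y) \<in> parcs (gtpt G)"
        by simp
      then have ne: "x \<noteq> []" "y \<noteq> []"
        using arc[OF xy] by auto
      have "(hd y # tl x, hd x # tl y) \<in> parcs G"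
        using xy gtpt_arc_iff[OF assms ne] by simp
      then have "(hd x # tl y, hd y # tl x) \<in> parcs G"
        using pair_sym_arcs by (auto simp: symmetric_def dest: symD)
      then show "(y, x) \<in> arcs_ends (with_proj (gtpt G))"
        using gtpt_arc_iff[OF assms ne(2,1)] by simp
    qed
  qed
qed

text \<open>Exchanging the first indices of row and column is the partial transpose in the first
  factor. Degree symmetry enters twice: it equates the traces, and it equates the diagonal entries,
  which the exchange leaves in place.\<close>

lemma rho_l_gtpt_entry:
  assumes "pair_graph G" "pverts G = vertex_labels Ns" "Ns \<noteq> []" "degree_symmetric G"
    and u: "u \<in> vertex_labels Ns" and v: "v \<in> vertex_labels Ns"
  shows "rho_l Ns (gtpt G) $$ (vertex_number Ns u - 1, vertex_number Ns v - 1) =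
    rho_l Ns G $$ (vertex_number Ns (hd v # tl u) - 1, vertex_number Ns (hd u # tl v) - 1)"
proof -
  have tr: "mat_trace (laplacian Ns (gtpt G)) = mat_trace (laplacian Ns G)"
    using assms(2,4) mat_trace_laplacian[OF assms(1,2)]
      mat_trace_laplacian[OF pair_graph_gtpt[OF assms(1-3)], of Ns]
    by (simp add: gtpt_def degree_symmetric_def)
  have sw: "hd v # tl u \<in> vertex_labels Ns" "hd u # tl v \<in> vertex_labels Ns"
    using swap_first_in_labels u v assms(3) by auto
  have ne: "u \<noteq> []" "v \<noteq> []"
    using u v assms(3) vertex_labels_nonempty by auto
  have arc: "(u, v) \<in> parcs (gtpt G) \<longleftrightarrow> (hd v # tl u, hd u # tl v) \<in> parcs G"
    by (rule gtpt_arc_iff[OF assms(1-3) ne])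
  have "laplacian Ns (gtpt G) $$ (vertex_number Ns u - 1, vertex_number Ns v - 1) =
      laplacian Ns G $$ (vertex_number Ns (hd v # tl u) - 1, vertex_number Ns (hd u # tl v) - 1)"
  proof (cases "u = v")
    case True
    moreover have "vertex_degree (gtpt G) u = vertex_degree G u"
      using assms(2,4) u by (simp add: degree_symmetric_def)
    moreover have "hd u # tl u = u"
      using ne by simp
    ultimately show ?thesis
      unfolding laplacian_entry_labels[OF u v] laplacian_entry_labels[OF sw] arc by simp
  next
    case False
    \<comment> \<open>Off-diagonal positions stay off-diagonal, so only the arc terms have to be
      compared.\<close>
    then have "hd v # tl u \<noteq> hd u # tl v"
      using ne by (cases u; cases v) auto
    with False show ?thesis
      unfolding laplacian_entry_labels[OF u v] laplacian_entry_labels[OF sw] arc by (simp only: if_False)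
  qed
  then show ?thesis
    using carrier_matD[OF laplacian_carrier, of Ns G] carrier_matD[OF laplacian_carrier, of Ns "gtpt G"]
      vertex_number_less[OF u] vertex_number_less[OF v]
      vertex_number_less[OF sw(1)] vertex_number_less[OF sw(2)]
    by (simp add: rho_l_def tr)
qed

section \<open>Separable decompositions\<close>

lemma foldr_plus_mat_entry:
  fixes F :: "'b \<Rightarrow> 'a :: comm_monoid_add mat"
  assumes "\<And>i. i \<in> set xs \<Longrightarrow> F i \<in> carrier_mat nr nc"
  shows "foldr (+) (map F xs) (0\<^sub>m nr nc) \<in> carrier_mat nr nc \<and>
    (\<forall>r<nr. \<forall>s<nc. foldr (+) (map F xs) (0\<^sub>m nr nc) $$ (r, s) = (\<Sum>i\<leftarrow>xs. F i $$ (r, s)))"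
  using assms by (induction xs) auto

text \<open>\<open>kronecker_list_entry\<close> yields the dimension only for given labels
  \<open>u\<close> and \<open>v\<close>; this version also covers an empty label set.\<close>

lemma kronecker_list_carrier:
  assumes "length As = length Ns" "\<forall>k<length Ns. As ! k \<in> carrier_mat (Ns ! k) (Ns ! k)"
  shows "kronecker_list As \<in> carrier_mat (prod_list Ns) (prod_list Ns)"
  using assms
proof (induction As Ns rule: list_induct2)
  case Nil
  show ?case by (simp add: kronecker_list_def)
next
  case (Cons B Bs N Ns)
  then have "B \<in> carrier_mat N N" "kronecker_list Bs \<in> carrier_mat (prod_list Ns) (prod_list Ns)"
    by (auto simp: nth_Cons split: nat.splits)
  then show ?case
    by (auto simp: kronecker_list_def kronecker_def)
qed

text \<open>Turns a decomposition into scalar identities indexed by pairs of labels. One direction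
  reads off the decomposition of \<open>rho_l Ns G\<close>, the other assembles that of
  \<open>rho_l Ns (gtpt G)\<close>.\<close>

lemma eq_product_combination_iff:
  fixes p :: "nat \<Rightarrow> real" and A :: "complex mat"
  assumes A: "A \<in> carrier_mat (prod_list Ns) (prod_list Ns)"
    and R: "\<forall>i<m. \<forall>j<length Ns. R i j \<in> carrier_mat (Ns ! j) (Ns ! j)"
  shows "A = foldr (+)
      (map (\<lambda>i. of_real (p i) \<cdot>\<^sub>m kronecker_list (map (R i) [0..<length Ns])) [0..<m])
      (0\<^sub>m (prod_list Ns) (prod_list Ns)) \<longleftrightarrow>
    (\<forall>u\<in>vertex_labels Ns. \<forall>v\<in>vertex_labels Ns.
       A $$ (vertex_number Ns u - 1, vertex_number Ns v - 1) =
       (\<Sum>i<m. of_real (p i) * (\<Prod>k<length Ns. R i k $$ (u ! k - 1, v ! k - 1))))"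
proof -
  let ?d = "prod_list Ns"
  let ?K = "\<lambda>i. kronecker_list (map (R i) [0..<length Ns])"
  let ?F = "foldr (+) (map (\<lambda>i. of_real (p i) \<cdot>\<^sub>m ?K i) [0..<m]) (0\<^sub>m ?d ?d)"
  let ?num = "\<lambda>u. vertex_number Ns u - 1"
  have K: "?K i \<in> carrier_mat ?d ?d" if "i < m" for i
    using kronecker_list_carrier[of "map (R i) [0..<length Ns]" Ns] R that by simp
  have F: "?F \<in> carrier_mat ?d ?d"
      "\<And>r s. r < ?d \<Longrightarrow> s < ?d \<Longrightarrow> ?F $$ (r, s) = (\<Sum>i<m. of_real (p i) * ?K i $$ (r, s))"
    using foldr_plus_mat_entry[of "[0..<m]" "\<lambda>i. of_real (p i) \<cdot>\<^sub>m ?K i" ?d ?d] K carrier_matD[OF K]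
    by (auto simp: interv_sum_list_conv_sum_set_nat atLeast0LessThan intro!: sum.cong)
  have entry: "?F $$ (?num u, ?num v) =
      (\<Sum>i<m. of_real (p i) * (\<Prod>k<length Ns. R i k $$ (u ! k - 1, v ! k - 1)))"
    if "u \<in> vertex_labels Ns" "v \<in> vertex_labels Ns" for u v
    unfolding F(2)[OF vertex_number_less[OF that(1)] vertex_number_less[OF that(2)]]
    using kronecker_list_entry[of "map (R i) [0..<length Ns]" Ns u v for i] R that
    by (intro sum.cong) auto
  have "A = ?F \<longleftrightarrow> (\<forall>r<?d. \<forall>s<?d. A $$ (r, s) = ?F $$ (r, s))"
    using A F(1) by (auto simp: mat_eq_iff)
  also have "\<dots> \<longleftrightarrow> (\<forall>u\<in>vertex_labels Ns. \<forall>v\<in>vertex_labels Ns.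
      A $$ (?num u, ?num v) = ?F $$ (?num u, ?num v))"
  proof (intro iffI ballI allI impI)
    fix r s
    assume *: "\<forall>u\<in>vertex_labels Ns. \<forall>v\<in>vertex_labels Ns.
        A $$ (?num u, ?num v) = ?F $$ (?num u, ?num v)" and rs: "r < ?d" "s < ?d"
    \<comment> \<open>Every row and column index is the number of some label, so comparing entries
      at labels compares the whole matrices.\<close>
    have "?num (vertex_at Ns r) = r" "?num (vertex_at Ns s) = s"
      using rs by (simp_all add: vertex_number_vertex_at)
    with *[rule_format, OF vertex_at_in_labels[OF rs(1)] vertex_at_in_labels[OF rs(2)]]
    show "A $$ (r, s) = ?F $$ (r, s)"
      by (simp only:)
  qed (use vertex_number_less in blast)
  also have "\<dots> \<longleftrightarrow> (\<forall>u\<in>vertex_labels Ns. \<forall>v\<in>vertex_labels Ns.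
      A $$ (?num u, ?num v) =
      (\<Sum>i<m. of_real (p i) * (\<Prod>k<length Ns. R i k $$ (u ! k - 1, v ! k - 1))))"
    by (simp only: entry cong: ball_cong)
  finally show ?thesis .
qed

theorem theorem2:
  fixes Ns :: "nat list" and G :: "nat list pair_pre_digraph"
  assumes "length Ns \<ge> 2" and "\<forall>k<length Ns. Ns ! k \<ge> 1"
    and "pair_graph G" and "pverts G = vertex_labels Ns" and "parcs G \<noteq> {}"
    and "degree_symmetric G"
    and "fully_separable Ns (rho_l Ns G)"
  shows "fully_separable Ns (rho_l Ns (gtpt G))"
proof -
  have Ns: "Ns \<noteq> []"
    using assms(1) by auto
  have dens: "density_matrix (prod_list Ns) (rho_l Ns (gtpt G))"
    using pair_graph_gtpt[OF assms(3,4) Ns] assms(4,5)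
    by (intro density_matrix_rho_l) (simp_all add: gtpt_def)
  have carrier: "rho_l Ns H \<in> carrier_mat (prod_list Ns) (prod_list Ns)" for H
    by (simp add: rho_l_def)
  obtain m p R where p: "\<forall>i<m. 0 \<le> p i" "(\<Sum>i<m. p i) = (1 :: real)"
    and R: "\<forall>i<m. \<forall>j<length Ns. density_matrix (Ns ! j) (R i j)"
    and dec: "rho_l Ns G = foldr (+)
      (map (\<lambda>i. of_real (p i) \<cdot>\<^sub>m kronecker_list (map (R i) [0..<length Ns])) [0..<m])
      (0\<^sub>m (prod_list Ns) (prod_list Ns))"
    using assms(7) unfolding fully_separable_def by blast
  have RC: "\<forall>i<m. \<forall>j<length Ns. R i j \<in> carrier_mat (Ns ! j) (Ns ! j)"
    using R by (simp add: density_matrix_def)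
  \<comment> \<open>Factors are counted from 0, so this transposes the first local state of each
    product; the weights \<open>p\<close> stay the same.\<close>
  define R' where "R' i j = (if j = 0 then transpose_mat (R i j) else R i j)" for i j :: nat
  have R': "\<forall>i<m. \<forall>j<length Ns. density_matrix (Ns ! j) (R' i j)"
    using R by (auto simp: R'_def density_matrix_transpose)
  have RC': "\<forall>i<m. \<forall>j<length Ns. R' i j \<in> carrier_mat (Ns ! j) (Ns ! j)"
    using R' by (simp add: density_matrix_def)
  have "rho_l Ns (gtpt G) $$ (vertex_number Ns u - 1, vertex_number Ns v - 1) =
      (\<Sum>i<m. of_real (p i) * (\<Prod>k<length Ns. R' i k $$ (u ! k - 1, v ! k - 1)))"
    if u: "u \<in> vertex_labels Ns" and v: "v \<in> vertex_labels Ns" for u v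
  proof -
    let ?u = "hd v # tl u" and ?v = "hd u # tl v"
    \<comment> \<open>Swapping heads alters the labels only at position 0, where it exchanges row
      and column index, as the transpose does. At other positions both sides coincide.\<close>
    have factor: "R' i k $$ (u ! k - 1, v ! k - 1) = R i k $$ (?u ! k - 1, ?v ! k - 1)"
      if "i < m" "k < length Ns" for i k
    proof -
      \<comment> \<open>The entries of a transposed matrix are determined only within its
        dimensions, so the indices must be in range.\<close>
      have bounds: "u ! k - 1 < Ns ! k" "v ! k - 1 < Ns ! k" "length u = length Ns" "length v = length Ns"
        using u v that(2) by (fastforce simp: vertex_labels_def)+
      have "R i k \<in> carrier_mat (Ns ! k) (Ns ! k)"
        using RC that by simp
      with bounds that(2) show ?thesis
        by (cases k; cases u; cases v) (auto simp: R'_def)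
    qed
    have "rho_l Ns (gtpt G) $$ (vertex_number Ns u - 1, vertex_number Ns v - 1) =
        rho_l Ns G $$ (vertex_number Ns ?u - 1, vertex_number Ns ?v - 1)"
      by (rule rho_l_gtpt_entry[OF assms(3,4) Ns assms(6) u v])
    also have "\<dots> = (\<Sum>i<m. of_real (p i) * (\<Prod>k<length Ns. R i k $$ (?u ! k - 1, ?v ! k - 1)))"
      by (rule iffD1[OF eq_product_combination_iff[OF carrier RC] dec, rule_format])
        (rule swap_first_in_labels[OF u v Ns] swap_first_in_labels[OF v u Ns])+
    also have "\<dots> = (\<Sum>i<m. of_real (p i) * (\<Prod>k<length Ns. R' i k $$ (u ! k - 1, v ! k - 1)))"
      by (intro sum.cong prod.cong refl arg_cong2[where f = times]) (simp only: factor lessThan_iff)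
    finally show ?thesis .
  qed
  then have "rho_l Ns (gtpt G) = foldr (+)
      (map (\<lambda>i. of_real (p i) \<cdot>\<^sub>m kronecker_list (map (R' i) [0..<length Ns])) [0..<m])
      (0\<^sub>m (prod_list Ns) (prod_list Ns))"
    by (intro iffD2[OF eq_product_combination_iff[OF carrier RC']] ballI)
  with dens p R' show ?thesis
    unfolding fully_separable_def by (intro conjI exI[of _ m] exI[of _ p] exI[of _ R'])
qed

end
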